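(* Let $(X,\|\cdot\|)$ be an infinite-dimensional separable Banach space over $\mathbb F$ ($\mathbb F=\mathbb R$ or $\mathbb F=\mathbb C$) and let $A$ be a hypercyclic linear operator in $X$ satisfying the following: $A$ is densely defined, each power $A^n$ ($n\in\mathbb N$) is a closed operator, and there exist a set $Y\subseteq C^\infty(A):=\bigcap_{n=1}^\infty D(A^n)$ dense in $X$ and a mapping $B:Y\to Y$ such that (1) for every $f\in Y$: $ABf=f$; and (2) for every $f\in Y$: $A^nf\to 0$ and $B^nf\to 0$ as $n\to\infty$. Then for each $\lambda\in\mathbb F$ with $|\lambda|=1$, the multiple $\lambda A$ is hypercyclic.
   Context: Operators may be unbounded; $D(\cdot)$ denotes the domain of an operator. The mapping $B:Y\to Y$ is not assumed linear or continuous, and $Y$ is only a set. A linear operator $T$ in a Banach space $X$ is called hypercyclic if there is a nonzero vector $f\in\bigcap_{n=0}^\infty D(T^n)$ (with $T^0:=I$) whose orbit $\{T^nf\}_{n\ge 0}$ is dense in $X$. *)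

theory Defs
  imports "HOL-Analysis.Analysis"
begin

text \<open>
  The scalar field is a type of class \<open>{real_normed_field, euclidean_space}\<close>. Both \<^typ>\<open>real\<close> and
  \<^typ>\<open>complex\<close> are instances, and up to isometric isomorphism over the reals there are no others:
  a finite-dimensional commutative real division algebra is the real or the complex numbers, and
  the multiplicative norm is then forced to be the usual modulus.

  A Banach space over this field is a type of class \<^class>\<open>banach\<close> (its underlying real Banach space)
  together with a scalar multiplication \<open>smul\<close> that extends \<^const>\<open>scaleR\<close> and for which the norm is
  homogeneous.
\<close>

locale banach_space_over = vector_space smul
  for smul :: "'k::{real_normed_field, euclidean_space} \<Rightarrow> 'a::banach \<Rightarrow> 'a" +
  assumes smul_of_real: "smul (of_real r) x = r *\<^sub>R x"
    and norm_smul: "norm (smul c x) = norm c * norm x"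

text \<open>
  An operator in \<open>X\<close> is given by its domain \<open>D\<close> and a total function \<open>T\<close>, of which only the
  values on \<open>D\<close> are meaningful.
\<close>

definition linear_operator :: "('k::field \<Rightarrow> 'a::ab_group_add \<Rightarrow> 'a) \<Rightarrow> 'a set \<Rightarrow> ('a \<Rightarrow> 'a) \<Rightarrow> bool"
  where "linear_operator smul D T \<longleftrightarrow>
    module.subspace smul D \<and>
    (\<forall>x\<in>D. \<forall>y\<in>D. T (x + y) = T x + T y) \<and>
    (\<forall>c. \<forall>x\<in>D. T (smul c x) = smul c (T x))"

definition closed_operator :: "'a::topological_space set \<Rightarrow> ('a \<Rightarrow> 'a) \<Rightarrow> bool"
  where "closed_operator D T \<longleftrightarrow> closed ((\<lambda>x. (x, T x)) ` D)"

text \<open>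
  The \<open>n\<close>-th power of the operator \<open>(D, T)\<close> is \<open>(power_dom D T n, T ^^ n)\<close>; on \<open>power_dom D T n\<close>
  the iterates only evaluate \<open>T\<close> inside \<open>D\<close>.
\<close>

primrec power_dom :: "'a set \<Rightarrow> ('a \<Rightarrow> 'a) \<Rightarrow> nat \<Rightarrow> 'a set"
  where
    "power_dom D T 0 = UNIV"
  | "power_dom D T (Suc n) = {x \<in> power_dom D T n. (T ^^ n) x \<in> D}"

definition C_infinity :: "'a set \<Rightarrow> ('a \<Rightarrow> 'a) \<Rightarrow> 'a set"
  where "C_infinity D T = (\<Inter>n\<in>{1..}. power_dom D T n)"

definition hypercyclic ::
    "('k::field \<Rightarrow> 'a::{ab_group_add, topological_space} \<Rightarrow> 'a) \<Rightarrow> 'a set \<Rightarrow> ('a \<Rightarrow> 'a) \<Rightarrow> bool"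
  where "hypercyclic smul D T \<longleftrightarrow>
    linear_operator smul D T \<and>
    (\<exists>f. f \<noteq> 0 \<and> f \<in> (\<Inter>n. power_dom D T n) \<and> closure (range (\<lambda>n. (T ^^ n) f)) = UNIV)"

end

(*
  Put T = c A with |c| = 1.  On Y the maps S n = c^(-n) B^n satisfy T^m S n = S (n - m) for m <= n,
  and T^n and S n have the same norms as A^n and B^n.  For a rapidly increasing sequence N and
  suitable vectors y k in Y that run through a dense set, the vector f = sum_k S (N k) (y k) is
  hypercyclic for T: closedness of T^j allows T^j to be applied termwise, and T^(N k) f is close to
  y k because the terms i < k contribute T^(N k - N i) (y i) and the terms i > k contribute
  S (N i - N k) (y i).  The S n form a family rather than the powers of a right inverse
  of T on Y because Y, being only a set, need not be invariant under multiplication by c.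
*)
theory Submission
  imports Defs
begin

section \<open>Powers of an unbounded linear operator\<close>

lemma C_infinity_subset_power_dom: "C_infinity D T \<subseteq> power_dom D T n"
  by (cases "n = 0") (auto simp: C_infinity_def)

lemma power_dom_linear:
  assumes "vector_space smul" "linear_operator smul D T"
  shows power_dom_zero: "0 \<in> power_dom D T n \<and> (T ^^ n) 0 = 0"
    and power_dom_add: "x \<in> power_dom D T n \<Longrightarrow> y \<in> power_dom D T n \<Longrightarrow>
      x + y \<in> power_dom D T n \<and> (T ^^ n) (x + y) = (T ^^ n) x + (T ^^ n) y"
    and power_dom_scale: "x \<in> power_dom D T n \<Longrightarrow>
      smul c x \<in> power_dom D T n \<and> (T ^^ n) (smul c x) = smul c ((T ^^ n) x)"
proof -
  interpret vector_space smul by fact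
  have D: "subspace D" and add: "\<And>x y. x \<in> D \<Longrightarrow> y \<in> D \<Longrightarrow> T (x + y) = T x + T y"
    and scale: "\<And>c x. x \<in> D \<Longrightarrow> T (smul c x) = smul c (T x)"
    using assms(2) by (auto simp: linear_operator_def)
  have T0: "T 0 = 0"
    using add[of 0 0] subspace_0[OF D] by simp
  show "0 \<in> power_dom D T n \<and> (T ^^ n) 0 = 0"
    by (induction n) (auto simp: T0 subspace_0[OF D])
  show "x \<in> power_dom D T n \<Longrightarrow> y \<in> power_dom D T n \<Longrightarrow>
      x + y \<in> power_dom D T n \<and> (T ^^ n) (x + y) = (T ^^ n) x + (T ^^ n) y"
    by (induction n) (auto simp: add subspace_add[OF D])
  show "x \<in> power_dom D T n \<Longrightarrow>
      smul c x \<in> power_dom D T n \<and> (T ^^ n) (smul c x) = smul c ((T ^^ n) x)"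
    by (induction n) (auto simp: scale subspace_scale[OF D])
qed

lemma power_dom_sum:
  assumes "vector_space smul" "linear_operator smul D T"
    and "\<And>i. i \<in> I \<Longrightarrow> x i \<in> power_dom D T n"
  shows "sum x I \<in> power_dom D T n \<and> (T ^^ n) (sum x I) = (\<Sum>i\<in>I. (T ^^ n) (x i))"
  using assms(3)
proof (induction I rule: infinite_finite_induct)
  case (insert i I)
  then show ?case
    using power_dom_add[OF assms(1,2), of "x i" n "sum x I"] by simp
qed (use power_dom_zero[OF assms(1,2)] in auto)

text \<open>Substitute for continuity: the points (partial sum, image of partial sum) lie on the
  graph of \<open>T ^^ n\<close> and converge to \<open>(f, g)\<close>, which stays on the graph
  because it is closed.\<close>

lemma closed_operator_power_sums:
  assumes "vector_space smul" "linear_operator smul D T"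
    and "closed_operator (power_dom D T n) (T ^^ n)"
    and dom: "\<And>i. x i \<in> power_dom D T n"
    and "x sums f" "(\<lambda>i. (T ^^ n) (x i)) sums g"
  shows "f \<in> power_dom D T n \<and> (T ^^ n) f = g"
proof -
  have in_graph: "(\<Sum>i<m. x i, \<Sum>i<m. (T ^^ n) (x i)) \<in> (\<lambda>x. (x, (T ^^ n) x)) ` power_dom D T n" for m
    using power_dom_sum[OF assms(1,2), of "{..<m}" x n] dom by (auto simp: image_iff)
  have lim: "(\<lambda>m. (\<Sum>i<m. x i, \<Sum>i<m. (T ^^ n) (x i))) \<longlonglongrightarrow> (f, g)"
    using assms(5,6) by (intro tendsto_Pair) (auto simp: sums_def)
  have "(f, g) \<in> (\<lambda>x. (x, (T ^^ n) x)) ` power_dom D T n"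
    by (rule closed_sequentially[OF _ in_graph lim]) (use assms(3) in \<open>simp add: closed_operator_def\<close>)
  then show ?thesis by auto
qed

section \<open>A hypercyclicity criterion for operators with closed powers\<close>

lemma lacunary_sequence:
  fixes L :: "nat \<Rightarrow> nat" and M :: "nat \<Rightarrow> nat \<Rightarrow> nat"
  obtains N :: "nat \<Rightarrow> nat" where "strict_mono N"
    and "\<And>i k. i < k \<Longrightarrow> L k \<le> N k - N i"
    and "\<And>i k. i < k \<Longrightarrow> M i k \<le> N k - N i"
proof -
  \<comment> \<open>\<open>K k\<close> is the increment of \<open>N\<close> at \<open>k\<close>.
    Only finitely many \<open>i\<close> precede \<open>k\<close>, so one number dominates
    \<open>L k\<close> and all \<open>M i k\<close> with \<open>i < k\<close>; the summand 1 makes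
    \<open>N\<close> strictly increasing.\<close>
  define K where "K k = 1 + L k + (\<Sum>i<k. M i k)" for k
  define N where "N k = (\<Sum>l\<le>k. K l)" for k
  have gap: "N i + K k \<le> N k" if "i < k" for i k
  proof -
    have "N i + K k = sum K (insert k {..i})"
      using that by (simp add: N_def)
    also have "\<dots> \<le> N k"
      unfolding N_def using that by (intro sum_mono2) auto
    finally show ?thesis .
  qed
  have M: "M i k \<le> K k" if "i < k" for i k
    using that member_le_sum[of i "{..<k}" "\<lambda>i. M i k"] by (simp add: K_def)
  show thesis
  proof
    show "strict_mono N"
    proof (rule strict_monoI)
      fix i k :: nat assume "i < k"
      then show "N i < N k" using gap[of i k] by (simp add: K_def)
    qed
    show "L k \<le> N k - N i" if "i < k" for i k
      using gap[OF that] by (simp add: K_def)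
    show "M i k \<le> N k - N i" if "i < k" for i k
      using gap[OF that] M[OF that] by simp
  qed
qed

text \<open>For each \<open>y\<close> in \<open>Y\<close> the sequence \<open>S n y\<close> is a
  backward orbit of \<open>y\<close> under \<open>T\<close> that tends to 0. The maps
  \<open>S n\<close> need not send \<open>Y\<close> into itself.\<close>

theorem hypercyclicity_criterion:
  fixes smul :: "'k::field \<Rightarrow> 'a::banach \<Rightarrow> 'a"
  assumes "vector_space smul" "linear_operator smul D T"
    and closed: "\<And>n. n \<ge> 1 \<Longrightarrow> closed_operator (power_dom D T n) (T ^^ n)"
    and nontrivial: "\<exists>x::'a. x \<noteq> 0"
    and separable: "separable_space (euclidean :: 'a topology)"
    and dense: "closure Y = UNIV"
    and S_dom: "\<And>n y. y \<in> Y \<Longrightarrow> S n y \<in> C_infinity D T"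
    and S_0: "\<And>y. y \<in> Y \<Longrightarrow> S 0 y = y"
    and T_S: "\<And>m n y. y \<in> Y \<Longrightarrow> m \<le> n \<Longrightarrow> (T ^^ m) (S n y) = S (n - m) y"
    and T_null: "\<And>y. y \<in> Y \<Longrightarrow> (\<lambda>n. (T ^^ n) y) \<longlonglongrightarrow> 0"
    and S_null: "\<And>y. y \<in> Y \<Longrightarrow> (\<lambda>n. S n y) \<longlonglongrightarrow> 0"
  shows "hypercyclic smul D T"
proof -
  obtain C :: "'a set" where C: "countable C" "closure C = UNIV"
    using separable by (auto simp: separable_space_def)
  \<comment> \<open>every point of \<open>C\<close> occurs infinitely often in \<open>z\<close>\<close>
  define z where "z k = from_nat_into C (fst (prod_decode k))" for k
  have "\<exists>y\<in>Y. dist y (z k) < (1/2)^k" for k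
    using dense closure_approachable[of "z k" Y] by simp
  then obtain y where y: "\<And>k. y k \<in> Y" "\<And>k. dist (y k) (z k) < (1/2)^k"
    by metis
  \<comment> \<open>The exponent is twice the index of the term: for a term \<open>i\<close> beyond
    \<open>k\<close>, \<open>(1/2)^(i+i)\<close> is below \<open>(1/2)^(i+k)\<close> whatever
    \<open>k < i\<close> is, so the threshold can depend on one index only.\<close>
  have "\<exists>L. \<forall>n\<ge>L. norm (S n (y k)) \<le> (1/2)^(k+k)" for k
    using LIMSEQ_D[OF S_null[OF y(1)], of "(1/2)^(k+k)" k] by (force intro: less_imp_le)
  then obtain L where L: "\<And>k n. n \<ge> L k \<Longrightarrow> norm (S n (y k)) \<le> (1/2)^(k+k)"
    by metis
  \<comment> \<open>The exponent \<open>i+k\<close> gives errors that are summable over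
    \<open>i\<close> with total at most \<open>2 * (1/2)^k\<close>.\<close>
  have "\<exists>M. \<forall>n\<ge>M. norm ((T ^^ n) (y i)) \<le> (1/2)^(i+k)" for i k
    using LIMSEQ_D[OF T_null[OF y(1)], of "(1/2)^(i+k)" i] by (force intro: less_imp_le)
  then obtain M where M: "\<And>i k n. n \<ge> M i k \<Longrightarrow> norm ((T ^^ n) (y i)) \<le> (1/2)^(i+k)"
    by metis
  obtain N where N: "strict_mono N"
    "\<And>i k. i < k \<Longrightarrow> L k \<le> N k - N i" "\<And>i k. i < k \<Longrightarrow> M i k \<le> N k - N i"
    using lacunary_sequence[of L M] by blast
  define x where "x i = S (N i) (y i)" for i
  have x_dom: "x i \<in> power_dom D T n" for i n
    using S_dom[OF y(1)] C_infinity_subset_power_dom[of D T n] unfolding x_def by blast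
  \<comment> \<open>Here \<open>(T ^^ j) (x i)\<close> equals \<open>S (N i - j) (y i)\<close>, and
    \<open>N i - j \<ge> N i - N k \<ge> L i\<close>. Allowing every \<open>j \<le> N k\<close>
    serves both the summability for arbitrary \<open>j\<close> and the estimate at
    \<open>j = N k\<close>.\<close>
  have later: "norm ((T ^^ j) (x i)) \<le> (1/2)^(i+i)" if "j \<le> N k" "k < i" for i j k
  proof -
    have "N k < N i" using N(1) that(2) by (simp add: strict_mono_less)
    then have "j \<le> N i" "N i - j \<ge> L i" using that N(2)[OF that(2)] by auto
    then show ?thesis using T_S[OF y(1)] L by (simp add: x_def)
  qed
  have summable: "summable (\<lambda>i. (T ^^ j) (x i))" for j
  proof (rule summable_comparison_test')
    show "summable (\<lambda>i. (1/2::real)^i)" by simp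
    \<comment> \<open>A strictly increasing \<open>N\<close> satisfies \<open>j \<le> N j\<close>,
      so \<open>later\<close> applies with \<open>k = j\<close> to all terms beyond
      \<open>j\<close>.\<close>
    fix i assume "i \<ge> Suc j"
    then have "norm ((T ^^ j) (x i)) \<le> (1/2)^(i+i)"
      using strict_mono_imp_increasing[OF N(1), of j] by (intro later[of j j i]) auto
    also have "\<dots> \<le> (1/2)^i" by (intro power_decreasing) auto
    finally show "norm ((T ^^ j) (x i)) \<le> (1/2)^i" .
  qed
  define f where "f = (\<Sum>i. x i)"
  have f: "f \<in> power_dom D T j" "(\<lambda>i. (T ^^ j) (x i)) sums (T ^^ j) f" for j
  proof -
    have "f \<in> power_dom D T j \<and> (\<lambda>i. (T ^^ j) (x i)) sums (T ^^ j) f"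
    \<comment> \<open>Closedness is assumed from the first power on; the zeroth power is the
      identity and is treated directly.\<close>
    proof (cases "j = 0")
      case True
      then show ?thesis using summable[of 0] by (simp add: f_def summable_sums)
    next
      case False
      then show ?thesis
        using closed_operator_power_sums[OF assms(1,2) closed[of j], of x f "\<Sum>i. (T ^^ j) (x i)"]
          x_dom summable[of 0] summable[of j] by (simp add: f_def summable_sums)
    qed
    then show "f \<in> power_dom D T j" "(\<lambda>i. (T ^^ j) (x i)) sums (T ^^ j) f" by auto
  qed
  have near: "dist ((T ^^ N k) f) (y k) \<le> 2 * (1/2)^k" for k
  proof -
    let ?a = "\<lambda>i. (T ^^ N k) (x i)"
    \<comment> \<open>The diagonal term \<open>?a k\<close> is \<open>S 0 (y k) = y k\<close>.
      Removing it leaves a series for the error \<open>(T ^^ N k) f - y k\<close>.\<close>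
    let ?b = "\<lambda>i. ?a i - (if i = k then ?a k else 0)"
    have b: "?b sums ((T ^^ N k) f - y k)"
      using sums_diff[OF f(2)[of "N k"] sums_single[of k "\<lambda>_. ?a k"]]
        T_S[OF y(1), of "N k" "N k" k] S_0[OF y(1)]
      by (simp add: x_def cong: if_cong)
    have le: "norm (?b i) \<le> (1/2)^(i+k)" for i
    proof (cases i k rule: linorder_cases)
      case less
      then have "N i \<le> N k" using N(1) by (simp add: strict_mono_less_eq)
      then have "?a i = (T ^^ (N k - N i)) ((T ^^ N i) (x i))"
        by (metis funpow_add comp_apply le_add_diff_inverse2)
      also have "(T ^^ N i) (x i) = y i"
        using T_S[OF y(1), of "N i" "N i" i] S_0[OF y(1)] by (simp add: x_def)
      finally show ?thesis using M[OF N(3)[OF less]] less by simp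
    next
      case greater
      then have "norm (?a i) \<le> (1/2)^(i+i)" by (intro later[of _ k]) auto
      also have "\<dots> \<le> (1/2)^(i+k)" using greater by (intro power_decreasing) auto
      finally show ?thesis using greater by simp
    qed simp
    have g: "(\<lambda>i. (1/2::real)^(i+k)) sums (2 * (1/2)^k)"
      using sums_mult2[OF geometric_sums[of "1/2::real"], of "(1/2)^k"] by (simp add: power_add)
    have "norm (suminf ?b) \<le> (\<Sum>i. (1/2::real)^(i+k))"
      by (rule norm_suminf_le[OF le sums_summable[OF g]])
    then show ?thesis using sums_unique[OF b] sums_unique[OF g] by (simp add: dist_norm)
  qed
  have "C \<subseteq> closure (range (\<lambda>n. (T ^^ n) f))"
  proof
    fix c assume "c \<in> C"
    then obtain j where j: "from_nat_into C j = c"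
      using from_nat_into_surj[OF C(1)] by blast
    show "c \<in> closure (range (\<lambda>n. (T ^^ n) f))"
    proof (subst closure_approachable, intro allI impI)
      fix e :: real assume "e > 0"
      then obtain m where m: "(1/2)^m < e / 3"
        using real_arch_pow_inv[of "e/3" "1/2"] by auto
      \<comment> \<open>This index satisfies \<open>z k = c\<close> and \<open>k \<ge> m\<close>, so
        it hits the chosen point with the required accuracy.\<close>
      define k where "k = prod_encode (j, m)"
      have "dist ((T ^^ N k) f) c \<le> dist ((T ^^ N k) f) (y k) + dist (y k) (z k)"
        using dist_triangle j by (simp add: z_def k_def)
      also have "\<dots> < 3 * (1/2)^k" using near[of k] y(2)[of k] by simp
      also have "\<dots> \<le> 3 * (1/2)^m"
        using le_prod_encode_2[of m j] by (simp add: k_def power_decreasing)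
      finally have "dist ((T ^^ N k) f) c < e" using m by simp
      then show "\<exists>u\<in>range (\<lambda>n. (T ^^ n) f). dist u c < e" by blast
    qed
  qed
  then have orbit: "closure (range (\<lambda>n. (T ^^ n) f)) = UNIV"
    using closure_minimal[of C] C(2) by blast
  moreover have "f \<noteq> 0"
  proof
    assume "f = 0"
    then have "range (\<lambda>n. (T ^^ n) f) = {0}"
      using power_dom_zero[OF assms(1,2)] by auto
    then show False using orbit nontrivial by auto
  qed
  ultimately show ?thesis using assms(2) f(1) unfolding hypercyclic_def by blast
qed

section \<open>Nonzero scalar multiples of an operator\<close>

context
  fixes smul :: "'k::field \<Rightarrow> 'a::{ab_group_add, topological_space} \<Rightarrow> 'a" and D A
  assumes vs: "vector_space smul" and lin: "linear_operator smul D A"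
begin

interpretation vector_space smul by (fact vs)

lemma linear_operator_smul: "linear_operator smul D (\<lambda>x. smul c (A x))"
  using lin by (auto simp: linear_operator_def scale_right_distrib mult.commute)

text \<open>The domain \<open>D\<close> is a subspace, so a nonzero factor does not affect
  membership in it, and linearity moves all factors to the front.\<close>

lemma power_smul:
  assumes "c \<noteq> 0"
  shows power_dom_smul: "power_dom D (\<lambda>x. smul c (A x)) n = power_dom D A n"
    and funpow_smul:
      "x \<in> power_dom D A n \<Longrightarrow> ((\<lambda>x. smul c (A x)) ^^ n) x = smul (c ^ n) ((A ^^ n) x)"
proof -
  let ?T = "\<lambda>x. smul c (A x)"
  have D: "subspace D" and A: "\<And>c x. x \<in> D \<Longrightarrow> A (smul c x) = smul c (A x)"
    using lin by (auto simp: linear_operator_def)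
  have D_iff: "smul d x \<in> D \<longleftrightarrow> x \<in> D" if "d \<noteq> 0" for d x
    using subspace_scale[OF D, of x d] subspace_scale[OF D, of "smul d x" "inverse d"] that by auto
  have "power_dom D ?T n = power_dom D A n \<and>
      (\<forall>x\<in>power_dom D A n. (?T ^^ n) x = smul (c ^ n) ((A ^^ n) x))"
  proof (induction n)
    case (Suc n)
    then show ?case using assms by (auto simp: D_iff A)
  qed simp
  then show "power_dom D ?T n = power_dom D A n"
    and "x \<in> power_dom D A n \<Longrightarrow> (?T ^^ n) x = smul (c ^ n) ((A ^^ n) x)"
    by auto
qed

end

lemma (in banach_space_over) continuous_on_smul: "continuous_on UNIV (smul c)"
proof -
  have "smul c (r *\<^sub>R x) = r *\<^sub>R smul c x" for r x
    by (metis smul_of_real scale_left_commute)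
  then have "bounded_linear (smul c)"
    by (intro bounded_linear_intro[where K = "norm c"])
      (auto simp: scale_right_distrib norm_smul mult.commute)
  then show ?thesis by (rule linear_continuous_on)
qed

text \<open>The new graph is the preimage of the old one under the continuous map
  \<open>(u, v)\<close> to \<open>(u, smul (inverse c) v)\<close>.\<close>

lemma (in banach_space_over) closed_operator_smul:
  assumes "closed_operator E S" "c \<noteq> 0"
  shows "closed_operator E (\<lambda>x. smul c (S x))"
proof -
  have inv: "y = smul c z \<longleftrightarrow> smul (inverse c) y = z" for y z
    using assms(2) by auto
  have "(\<lambda>x. (x, smul c (S x))) ` E =
      (\<lambda>p. (fst p, smul (inverse c) (snd p))) -` (\<lambda>x. (x, S x)) ` E"
    by (auto simp: image_iff prod_eq_iff assms(2) simp flip: inv)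
  moreover have "continuous_on UNIV (\<lambda>p::'a \<times> 'a. (fst p, smul (inverse c) (snd p)))"
    by (intro continuous_intros continuous_on_compose2[OF continuous_on_smul]) auto
  ultimately show ?thesis
    using assms(1) by (auto simp: closed_operator_def intro: closed_vimage)
qed

section \<open>Application to unimodular multiples\<close>

theorem corollary4p4:
  fixes smul :: "'k::{real_normed_field, euclidean_space} \<Rightarrow> 'a::banach \<Rightarrow> 'a"
    and D Y :: "'a set"
    and A B :: "'a \<Rightarrow> 'a"
  assumes "banach_space_over smul"
    and "\<nexists>Basis. finite_dimensional_vector_space smul Basis"
    and "separable_space (euclidean :: 'a topology)"
    and "hypercyclic smul D A"
    and "closure D = UNIV"
    and "\<And>n. n \<ge> 1 \<Longrightarrow> closed_operator (power_dom D A n) (A ^^ n)"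
    and "Y \<subseteq> C_infinity D A"
    and "closure Y = UNIV"
    and "B \<in> Y \<rightarrow> Y"
    and "\<And>f. f \<in> Y \<Longrightarrow> A (B f) = f"
    and "\<And>f. f \<in> Y \<Longrightarrow> (\<lambda>n. (A ^^ n) f) \<longlonglongrightarrow> 0"
    and "\<And>f. f \<in> Y \<Longrightarrow> (\<lambda>n. (B ^^ n) f) \<longlonglongrightarrow> 0"
  shows "\<forall>c::'k. norm c = 1 \<longrightarrow> hypercyclic smul D (\<lambda>x. smul c (A x))"
proof (intro allI impI)
  fix c :: 'k assume c: "norm c = 1"
  then have c0: "c \<noteq> 0" by auto
  interpret banach_space_over smul by fact
  have lin: "linear_operator smul D A" and nontrivial: "\<exists>x::'a. x \<noteq> 0"
    using assms(4) by (auto simp: hypercyclic_def)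
  let ?T = "\<lambda>x. smul c (A x)"
  have dom: "power_dom D ?T n = power_dom D A n" for n
    by (rule power_dom_smul[OF vector_space_axioms lin c0])
  have T: "(?T ^^ n) x = smul (c ^ n) ((A ^^ n) x)" if "x \<in> power_dom D A n" for x n
    using funpow_smul[OF vector_space_axioms lin c0 that] .
  define S where "S n y = smul (inverse c ^ n) ((B ^^ n) y)" for n y
  have BY: "(B ^^ n) y \<in> Y" if "y \<in> Y" for n y
    by (induction n) (use that assms(9) in auto)
  have Y_dom: "y \<in> power_dom D A n" if "y \<in> Y" for n y
    using that assms(7) C_infinity_subset_power_dom[of D A n] by blast
  \<comment> \<open>The induction cancels the innermost \<open>A\<close> against the outermost
    \<open>B\<close>, which is legitimate because all iterates of \<open>B\<close> stay in
    \<open>Y\<close>.\<close>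
  have AB: "(A ^^ m) ((B ^^ (k + m)) y) = (B ^^ k) y" if "y \<in> Y" for k m y
  proof (induction m)
    case (Suc m)
    have "(A ^^ Suc m) ((B ^^ (k + Suc m)) y) = (A ^^ m) (A (B ((B ^^ (k + m)) y)))"
      by (simp add: funpow_swap1)
    then show ?case using Suc assms(10) BY[OF that] by simp
  qed simp
  have scale: "smul d x \<in> power_dom D A n \<and> (A ^^ n) (smul d x) = smul d ((A ^^ n) x)"
    if "x \<in> power_dom D A n" for d x n
    by (rule power_dom_scale[OF vector_space_axioms lin that])
  show "hypercyclic smul D ?T"
  proof (rule hypercyclicity_criterion[where S = S and Y = Y])
    show "vector_space smul" by (rule vector_space_axioms)
    show "linear_operator smul D ?T"
      by (rule linear_operator_smul[OF vector_space_axioms lin])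
    show "closed_operator (power_dom D ?T n) (?T ^^ n)" if "n \<ge> 1" for n
    proof -
      have "closed_operator (power_dom D A n) (\<lambda>x. smul (c ^ n) ((A ^^ n) x))"
        using assms(6)[OF that] c0 by (intro closed_operator_smul) auto
      \<comment> \<open>Outside the power domain the two functions may differ, so their graphs over
        it are compared.\<close>
      moreover have "(\<lambda>x. (x, (?T ^^ n) x)) ` power_dom D A n =
          (\<lambda>x. (x, smul (c ^ n) ((A ^^ n) x))) ` power_dom D A n"
        by (rule image_cong) (auto simp: T)
      ultimately show ?thesis by (simp add: closed_operator_def dom)
    qed
    fix y assume y: "y \<in> Y"
    show "S n y \<in> C_infinity D ?T" for n
      using scale[OF Y_dom[OF BY[OF y]]] by (auto simp: C_infinity_def S_def dom)
    show "S 0 y = y" by (simp add: S_def)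
    show "(?T ^^ m) (S n y) = S (n - m) y" if "m \<le> n" for m n
    proof -
      have "(A ^^ m) ((B ^^ n) y) = (B ^^ (n - m)) y"
        using AB[OF y, of m "n - m"] that by simp
      moreover have "c ^ m * inverse c ^ n = inverse c ^ (n - m)"
        using that c0 by (simp add: power_diff field_simps)
      ultimately show ?thesis
        using scale[OF Y_dom[OF BY[OF y]]] T by (simp add: S_def)
    qed
    \<comment> \<open>Powers of \<open>c\<close> and of its inverse have norm 1, so both null
      sequences survive the rescaling.\<close>
    have "(\<lambda>n. norm ((?T ^^ n) y)) = (\<lambda>n. norm ((A ^^ n) y))"
      using c by (auto simp: T Y_dom[OF y] norm_smul norm_power)
    then show "(\<lambda>n. (?T ^^ n) y) \<longlonglongrightarrow> 0"
      using assms(11)[OF y] by (metis tendsto_norm_zero_iff)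
    have "(\<lambda>n. norm (S n y)) = (\<lambda>n. norm ((B ^^ n) y))"
      using c by (auto simp: S_def norm_smul norm_power norm_inverse)
    then show "(\<lambda>n. S n y) \<longlonglongrightarrow> 0"
      using assms(12)[OF y] by (metis tendsto_norm_zero_iff)
  qed (fact nontrivial assms(3,8))+
qed

end
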